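(* Let $\mathcal{G}$ be a minor-closed class of ribbon graphs (closed under deletion and contraction of edges). Then there is a unique map $U:\mathcal{G}\to\mathbb{Z}[\gamma,a_{\mathrm{b}}^{1/2},a_{\mathrm{ol}}^{1/2},b_{\mathrm{b}}^{1/2},b_{\mathrm{ol}}^{1/2}]$ such that $U(\mathbb{G})=a_iU(\mathbb{G}\backslash e)+b_jU(\mathbb{G}/e)$ whenever $e$ is an edge of $\mathbb{G}$ of type $(i,j)$, and $U(\mathbb{G})=\gamma^v$ whenever $\mathbb{G}$ is edgeless with $v$ vertices, where $a_{\mathrm{nl}}=a_{\mathrm{b}}^{1/2}a_{\mathrm{ol}}^{1/2}$ and $b_{\mathrm{nl}}=b_{\mathrm{b}}^{1/2}b_{\mathrm{ol}}^{1/2}$. Moreover, $$U(\mathbb{G})=\gamma^{v(\mathbb{G})-\rho(\mathbb{G})}b_{\mathrm{b}}^{\rho(\mathbb{G})}a_{\mathrm{ol}}^{|E|-\rho(\mathbb{G})}\,T_{cs}\Big(\mathbb{G};\frac{\gamma a_{\mathrm{b}}}{b_{\mathrm{b}}},\frac{\gamma b_{\mathrm{ol}}}{a_{\mathrm{ol}}}\Big).$$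
   Context: A ribbon graph $\mathbb{G}=(V,E)$ is a surface with boundary represented as a union of two finite sets of closed discs, vertices and edges, meeting in disjoint line segments, each on the boundary of exactly one vertex and one edge, each edge containing exactly two such segments; ribbon graphs are considered up to homeomorphisms preserving vertices and edges (orientation preserving if orientable). A loop is an edge meeting one vertex; non-orientable if its union with its vertex is a Möbius band, orientable otherwise. Deletion $\mathbb{G}\backslash e$ removes $e$; contraction $\mathbb{G}/e$ glues a disc (new vertex) along each boundary component of $e\cup u\cup v$ ($u,v$ the ends of $e$) and removes $e,u,v$. $e^c=E\setminus\{e\}$; sets are deleted/contracted edge by edge. Edge types: $\mathrm{b}$ = one edge joining two distinct vertices; $\mathrm{ol}$ = one vertex with an orientable loop; $\mathrm{nl}$ = one vertex with a non-orientable loop. Edge $e$ is of type $(i,j)$ if, after removing isolated vertices, $\mathbb{G}/e^c=i$ and $\mathbb{G}\backslash e^c=j$. $v(\mathbb{G})=|V|$; $b(A)$ is the number of boundary components of the ribbon subgraph $(V,A)$; $\rho(A)=\frac12(|A|+|V|-b(A))$ (equivalently rank plus half the Euler genus of $(V,A)$), $\rho(\mathbb{G})=\rho(E)$. The Tutte polynomial of a ribbon graph is $T_{cs}(\mathbb{G};x,y)=\sum_{A\subseteq E}x^{\rho(\mathbb{G})-\rho(A)}y^{|A|-\rho(A)}$. *)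

theory Defs
  imports Complex_Main "HOL-Library.Poly_Mapping" "HOL-Library.FuncSet"
begin

section \<open>Ribbon graphs\<close>

text \<open>
  A closed disc is determined up to homeomorphism by its boundary circle, so a ribbon graph is
  determined, up to homeomorphisms preserving vertices and edges, by the way the boundary circles
  of its discs are cut into arcs by the end points of the line segments in which vertices and edges
  meet. These end points are the flags. Every flag \<open>f\<close> is an end point of exactly three arcs, and
  the record gives the other end point of each of them:
    \<^item> \<open>seg G f\<close>: along the line segment common to a vertex and an edge;
    \<^item> \<open>side G f\<close>: along the arc of the boundary of the edge between its two segments;
    \<^item> \<open>corner G f\<close>: along the arc of the boundary of the vertex that leads to the neighbouring
      segment on this vertex (possibly the same segment, if it is the only one).
  The boundary circle of an edge carries exactly two segments, hence four flags in the cyclic order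
  \<open>f\<close>, \<open>seg f\<close>, \<open>side (seg f)\<close>, \<open>side f\<close>. An isolated vertex carries no flag, and isolated
  vertices are indistinguishable, so only their number is recorded.
\<close>

record 'a ribbon =
  flags :: "'a set"
  seg :: "'a \<Rightarrow> 'a"
  side :: "'a \<Rightarrow> 'a"
  corner :: "'a \<Rightarrow> 'a"
  isolated :: nat

definition free_involution_on :: "'a set \<Rightarrow> ('a \<Rightarrow> 'a) \<Rightarrow> bool" where
  "free_involution_on F t \<longleftrightarrow> (\<forall>f\<in>F. t f \<in> F \<and> t f \<noteq> f \<and> t (t f) = f)"

definition ribbon_graph :: "'a ribbon \<Rightarrow> bool" where
  "ribbon_graph G \<longleftrightarrow>
     finite (flags G) \<and>
     free_involution_on (flags G) (seg G) \<and>
     free_involution_on (flags G) (side G) \<and>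
     free_involution_on (flags G) (corner G) \<and>
     (\<forall>f\<in>flags G. seg G (side G f) = side G (seg G f) \<and> seg G f \<noteq> side G f)"

text \<open>An edge is identified with the set of its four flags.\<close>

definition edges :: "'a ribbon \<Rightarrow> 'a set set" where
  "edges G = (\<lambda>f. {f, seg G f, side G f, seg G (side G f)}) ` flags G"

text \<open>
  For \<open>A \<subseteq> edges G\<close>, the boundary of the ribbon subgraph \<open>(V, A)\<close> consists of the corner arcs, the
  side arcs of the edges in \<open>A\<close>, and the segments of the edges not in \<open>A\<close> (these segments lie on
  the boundary of a vertex and are no longer covered by an edge). \<open>cross G A\<close> is the non-corner
  step along this boundary; each of its components is represented by the set of flags on it, except
  for the boundary circles of isolated vertices.
\<close>

definition cross :: "'a ribbon \<Rightarrow> 'a set set \<Rightarrow> 'a \<Rightarrow> 'a" where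
  "cross G A f = (if f \<in> \<Union>A then side G f else seg G f)"

definition boundary_step :: "'a ribbon \<Rightarrow> 'a set set \<Rightarrow> ('a \<times> 'a) set" where
  "boundary_step G A = {(f, g). f \<in> flags G \<and> (g = corner G f \<or> g = cross G A f)}"

definition boundary_circles :: "'a ribbon \<Rightarrow> 'a set set \<Rightarrow> 'a set set" where
  "boundary_circles G A = flags G // (boundary_step G A)\<^sup>*"

definition num_boundary :: "'a ribbon \<Rightarrow> 'a set set \<Rightarrow> nat" where
  "num_boundary G A = card (boundary_circles G A) + isolated G"

text \<open>The non-isolated vertices, as the sets of flags on their boundary circles.\<close>

definition vertices :: "'a ribbon \<Rightarrow> 'a set set" where
  "vertices G = boundary_circles G {}"

definition num_vertices :: "'a ribbon \<Rightarrow> nat" where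
  "num_vertices G = card (vertices G) + isolated G"

text \<open>
  Two ribbon graphs are related by a homeomorphism preserving vertices and edges iff there is a
  bijection of the flags respecting the three kinds of arcs, and they have equally many isolated
  vertices.
\<close>

definition homeomorphic_rg :: "'a ribbon \<Rightarrow> 'b ribbon \<Rightarrow> bool" where
  "homeomorphic_rg G H \<longleftrightarrow> isolated G = isolated H \<and>
     (\<exists>\<phi>. bij_betw \<phi> (flags G) (flags H) \<and>
        (\<forall>f\<in>flags G. \<phi> (seg G f) = seg H (\<phi> f) \<and> \<phi> (side G f) = side H (\<phi> f) \<and>
                      \<phi> (corner G f) = corner H (\<phi> f)))"

text \<open>
  A local orientation of the surface at a flag is transported to the opposite one by each of the
  three involutions (an orientation picks, at each flag, a cyclic order of the three arcs, and the
  involutions act as reflections); so the surface is orientable iff the flags can be coloured with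
  two colours such that each involution changes the colour.
\<close>

definition orientable :: "'a ribbon \<Rightarrow> bool" where
  "orientable G \<longleftrightarrow> (\<exists>S. \<forall>f\<in>flags G.
     (seg G f \<in> S \<longleftrightarrow> f \<notin> S) \<and> (side G f \<in> S \<longleftrightarrow> f \<notin> S) \<and> (corner G f \<in> S \<longleftrightarrow> f \<notin> S))"


section \<open>Deletion and contraction\<close>

text \<open>
  \<open>excise G e A\<close> has the edges of \<open>G\<close> other than \<open>e\<close>, and one vertex for each component of the
  boundary of \<open>(V, A)\<close>, glued along that component.
    \<^item> For \<open>A = {}\<close> these components bound the vertices of \<open>G\<close>: this is deletion.
    \<^item> For \<open>A = {e}\<close> they are the boundary components of the union of \<open>e\<close> and its ends, together with
      the boundaries of the vertices not meeting \<open>e\<close>: this is contraction.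
  The corner partner of a remaining flag is found by following the boundary component, alternating
  between corners and \<open>cross G A\<close>, until a flag not on \<open>e\<close> is reached. Components all of whose
  flags belong to \<open>e\<close> bound new isolated vertices.
\<close>

definition excise :: "'a ribbon \<Rightarrow> 'a set \<Rightarrow> 'a set set \<Rightarrow> 'a ribbon" where
  "excise G e A =
     \<lparr> flags = flags G - e,
       seg = seg G,
       side = side G,
       corner = (\<lambda>f. let follow = (\<lambda>n. ((corner G \<circ> cross G A) ^^ n) (corner G f))
                     in follow (LEAST n. follow n \<notin> e)),
       isolated = isolated G + card {C \<in> boundary_circles G A. C \<subseteq> e} \<rparr>"

definition delete :: "'a ribbon \<Rightarrow> 'a set \<Rightarrow> 'a ribbon" where
  "delete G e = excise G e {}"

definition contract :: "'a ribbon \<Rightarrow> 'a set \<Rightarrow> 'a ribbon" where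
  "contract G e = excise G e {e}"

definition delete_list :: "'a ribbon \<Rightarrow> 'a set list \<Rightarrow> 'a ribbon" where
  "delete_list = foldl delete"

definition contract_list :: "'a ribbon \<Rightarrow> 'a set list \<Rightarrow> 'a ribbon" where
  "contract_list = foldl contract"

definition minor_closed :: "'a ribbon set \<Rightarrow> bool" where
  "minor_closed \<G> \<longleftrightarrow>
     (\<forall>G\<in>\<G>. ribbon_graph G \<and> (\<forall>e\<in>edges G. delete G e \<in> \<G> \<and> contract G e \<in> \<G>))"


section \<open>Edge types\<close>

text \<open>\<open>BB\<close>, \<open>OL\<close> and \<open>NL\<close> stand for the types b, ol and nl.\<close>

datatype edge_type = BB | OL | NL

definition remove_isolated :: "'a ribbon \<Rightarrow> 'a ribbon" where
  "remove_isolated G = G\<lparr>isolated := 0\<rparr>"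

text \<open>
  The union of a vertex and one loop is an annulus if it is orientable, and a Moebius band
  otherwise.
\<close>

fun is_one_edge_graph :: "'a ribbon \<Rightarrow> edge_type \<Rightarrow> bool" where
  "is_one_edge_graph G BB \<longleftrightarrow> num_vertices G = 2 \<and>
     (\<exists>e u v. edges G = {e} \<and> vertices G = {u, v} \<and> u \<noteq> v)"
| "is_one_edge_graph G OL \<longleftrightarrow> num_vertices G = 1 \<and>
     (\<exists>e u. edges G = {e} \<and> vertices G = {u}) \<and> orientable G"
| "is_one_edge_graph G NL \<longleftrightarrow> num_vertices G = 1 \<and>
     (\<exists>e u. edges G = {e} \<and> vertices G = {u}) \<and> \<not> orientable G"

text \<open>The result of deleting or contracting several edges does not depend on their order.\<close>

definition edge_has_type :: "'a ribbon \<Rightarrow> 'a set \<Rightarrow> edge_type \<Rightarrow> edge_type \<Rightarrow> bool" where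
  "edge_has_type G e i j \<longleftrightarrow>
     (\<exists>es. distinct es \<and> set es = edges G - {e} \<and>
        is_one_edge_graph (remove_isolated (contract_list G es)) i \<and>
        is_one_edge_graph (remove_isolated (delete_list G es)) j)"


section \<open>Polynomials with fractional exponents\<close>

text \<open>
  \<open>'v gpoly\<close> is the ring of integer combinations of monomials in the variables \<open>'v\<close> with rational
  exponents. It contains the polynomials in the square roots of the variables, and also the
  fractional and negative powers used in the closed formula.
\<close>

type_synonym 'v gmonom = "'v \<Rightarrow>\<^sub>0 rat"
type_synonym 'v gpoly = "'v gmonom \<Rightarrow>\<^sub>0 int"

definition var_pow :: "'v \<Rightarrow> rat \<Rightarrow> 'v gpoly" where
  "var_pow v r = Poly_Mapping.single (Poly_Mapping.single v r) 1"

text \<open>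
  \<open>subst_monom \<sigma> p\<close> substitutes the monomial \<open>\<sigma> u\<close> for each variable \<open>u\<close> of \<open>p\<close>; raising a monomial
  to a rational power multiplies its exponents.
\<close>

definition subst_monom :: "('u \<Rightarrow> 'v gmonom) \<Rightarrow> 'u gpoly \<Rightarrow> 'v gpoly" where
  "subst_monom \<sigma> p = (\<Sum>m\<in>Poly_Mapping.keys p. Poly_Mapping.single
     (\<Sum>u\<in>Poly_Mapping.keys m. Poly_Mapping.map ((*) (Poly_Mapping.lookup m u)) (\<sigma> u))
     (Poly_Mapping.lookup p m))"


section \<open>The Tutte polynomial of a ribbon graph\<close>

definition rho :: "'a ribbon \<Rightarrow> 'a set set \<Rightarrow> rat" where
  "rho G A = (of_nat (card A) + of_nat (num_vertices G) - of_nat (num_boundary G A)) / 2"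

abbreviation rho_total :: "'a ribbon \<Rightarrow> rat" where
  "rho_total G \<equiv> rho G (edges G)"

datatype xy = X | Y

definition tutte_cs :: "'a ribbon \<Rightarrow> xy gpoly" where
  "tutte_cs G = (\<Sum>A\<in>Pow (edges G).
     var_pow X (rho_total G - rho G A) * var_pow Y (of_nat (card A) - rho G A))"


section \<open>Deletion-contraction invariants\<close>

text \<open>The variables \<open>\<gamma>\<close>, \<open>a\<^sub>b\<close>, \<open>a\<^sub>o\<^sub>l\<close>, \<open>b\<^sub>b\<close>, \<open>b\<^sub>o\<^sub>l\<close>.\<close>

datatype var = Gam | A_b | A_ol | B_b | B_ol

text \<open>The ring \<open>\<int>[\<gamma>, a\<^sub>b\<^sup>1\<^sup>/\<^sup>2, a\<^sub>o\<^sub>l\<^sup>1\<^sup>/\<^sup>2, b\<^sub>b\<^sup>1\<^sup>/\<^sup>2, b\<^sub>o\<^sub>l\<^sup>1\<^sup>/\<^sup>2]\<close>.\<close>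

definition coeff_ring :: "var gpoly set" where
  "coeff_ring = {p. \<forall>m\<in>Poly_Mapping.keys p.
     Poly_Mapping.lookup m Gam \<in> \<nat> \<and> (\<forall>v. 2 * Poly_Mapping.lookup m v \<in> \<nat>)}"

fun a_coeff :: "edge_type \<Rightarrow> var gpoly" where
  "a_coeff BB = var_pow A_b 1"
| "a_coeff OL = var_pow A_ol 1"
| "a_coeff NL = var_pow A_b (1/2) * var_pow A_ol (1/2)"

fun b_coeff :: "edge_type \<Rightarrow> var gpoly" where
  "b_coeff BB = var_pow B_b 1"
| "b_coeff OL = var_pow B_ol 1"
| "b_coeff NL = var_pow B_b (1/2) * var_pow B_ol (1/2)"

text \<open>
  Extensionality outside \<open>\<G>\<close> makes \<open>U\<close> a map with domain exactly \<open>\<G>\<close>. Invariance under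
  homeomorphism is deliberately not required here: uniqueness then holds among all maps on
  representatives, in particular among those constant on homeomorphism classes, whichever
  convention on preserving orientations is used.
\<close>

definition deletion_contraction_map ::
  "'a ribbon set \<Rightarrow> ('a ribbon \<Rightarrow> var gpoly) \<Rightarrow> bool" where
  "deletion_contraction_map \<G> U \<longleftrightarrow>
     U \<in> \<G> \<rightarrow>\<^sub>E coeff_ring \<and>
     (\<forall>G\<in>\<G>. \<forall>e\<in>edges G. \<forall>i j. edge_has_type G e i j \<longrightarrow>
        U G = a_coeff i * U (delete G e) + b_coeff j * U (contract G e)) \<and>
     (\<forall>G\<in>\<G>. edges G = {} \<longrightarrow> U G = var_pow Gam 1 ^ num_vertices G)"

definition homeo_invariant_on :: "'a ribbon set \<Rightarrow> ('a ribbon \<Rightarrow> 'c) \<Rightarrow> bool" where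
  "homeo_invariant_on \<G> U \<longleftrightarrow> (\<forall>G\<in>\<G>. \<forall>H\<in>\<G>. homeomorphic_rg G H \<longrightarrow> U G = U H)"

text \<open>The monomials \<open>\<gamma> a\<^sub>b / b\<^sub>b\<close> and \<open>\<gamma> b\<^sub>o\<^sub>l / a\<^sub>o\<^sub>l\<close>.\<close>

fun tutte_args :: "xy \<Rightarrow> var gmonom" where
  "tutte_args X = Poly_Mapping.single Gam 1 + Poly_Mapping.single A_b 1 - Poly_Mapping.single B_b 1"
| "tutte_args Y = Poly_Mapping.single Gam 1 + Poly_Mapping.single B_ol 1 - Poly_Mapping.single A_ol 1"

end

theory Submission
  imports Defs
begin

text \<open>
  With the definition of \<open>\<rho>\<close> the closed formula becomes a sum over \<open>A \<subseteq> E\<close> of the monomials with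
  exponent \<open>b(A)\<close> of \<open>\<gamma>\<close>, \<open>\<rho>(E) - \<rho>(A)\<close> of \<open>a\<^sub>b\<close>, \<open>|E| - |A| - \<rho>(E) + \<rho>(A)\<close> of \<open>a\<^sub>o\<^sub>l\<close>,
  \<open>\<rho>(A)\<close> of \<open>b\<^sub>b\<close> and \<open>|A| - \<rho>(A)\<close> of \<open>b\<^sub>o\<^sub>l\<close>. Splitting it according to whether \<open>e \<in> A\<close> gives
  the recursion: the boundary of \<open>(V, A)\<close> is unchanged by deleting \<open>e \<notin> A\<close> or contracting
  \<open>e \<in> A\<close>, and an edge of type \<open>(i, j)\<close> satisfies \<open>\<rho>(E) - \<rho>(E - e) = r(i)\<close> and \<open>\<rho>({e}) = r(j)\<close>,
  where \<open>r\<close> is 1, 0, 1/2 for b, ol, nl. The exponents are admissible because the recursion produces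
  only admissible ones. Uniqueness is induction on the number of edges, as every edge has a type.
\<close>

section \<open>Orbits of two involutions\<close>

text \<open>Vertices and boundary components alike are orbits of the corner involution
  \<open>c\<close> and a second involution \<open>t\<close>, so the removal of an edge is studied
  once, for abstract \<open>c\<close> and \<open>t\<close>.\<close>

definition steps :: "'a set \<Rightarrow> ('a \<Rightarrow> 'a) \<Rightarrow> ('a \<Rightarrow> 'a) \<Rightarrow> ('a \<times> 'a) set" where
  "steps F c t = {(f, g). f \<in> F \<and> (g = c f \<or> g = t f)}"

definition orbits :: "'a set \<Rightarrow> ('a \<Rightarrow> 'a) \<Rightarrow> ('a \<Rightarrow> 'a) \<Rightarrow> 'a set set" where
  "orbits F c t = F // (steps F c t)\<^sup>*"

lemma free_involution_onD:
  assumes "free_involution_on F c" "f \<in> F"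
  shows "c f \<in> F" "c f \<noteq> f" "c (c f) = f"
  using assms by (auto simp: free_involution_on_def)

lemma equiv_steps:
  assumes "free_involution_on F c" "free_involution_on F t"
  shows "equiv UNIV ((steps F c t)\<^sup>*)"
proof -
  have "sym (steps F c t)"
    using assms by (auto simp: sym_def steps_def free_involution_on_def)
  then show ?thesis
    by (simp add: equiv_def sym_rtrancl refl_rtrancl trans_rtrancl)
qed

lemma rtrancl_stepsI:
  assumes "(f, g) \<in> (steps F c t)\<^sup>*" "g \<in> F"
  shows "(f, c g) \<in> (steps F c t)\<^sup>*" "(f, t g) \<in> (steps F c t)\<^sup>*"
  using assms by (auto simp: steps_def intro: rtrancl.rtrancl_into_rtrancl)

lemma rtrancl_steps_closed:
  assumes "(f, g) \<in> (steps F c t)\<^sup>*" "f \<in> K"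
    "\<And>x. x \<in> K \<Longrightarrow> x \<in> F \<Longrightarrow> c x \<in> K" "\<And>x. x \<in> K \<Longrightarrow> x \<in> F \<Longrightarrow> t x \<in> K"
  shows "g \<in> K"
  using assms(1) by (induction rule: rtrancl_induct) (use assms(2-) in \<open>auto simp: steps_def\<close>)

text \<open>Both inclusions are closure arguments: the image of the orbit is closed under
  \<open>c'\<close> and \<open>t'\<close>, and the points that \<phi> sends into the orbit of
  \<open>\<phi> f\<close> are closed under \<open>c\<close> and \<open>t\<close>.\<close>

lemma orbit_image:
  assumes "f \<in> F" "c ` F \<subseteq> F" "t ` F \<subseteq> F"
    and "\<And>x. x \<in> F \<Longrightarrow> c' (\<phi> x) = \<phi> (c x)" "\<And>x. x \<in> F \<Longrightarrow> t' (\<phi> x) = \<phi> (t x)"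
  shows "(steps (\<phi> ` F) c' t')\<^sup>* `` {\<phi> f} = \<phi> ` ((steps F c t)\<^sup>* `` {f})"
proof (intro equalityI subsetI)
  fix y assume "y \<in> (steps (\<phi> ` F) c' t')\<^sup>* `` {\<phi> f}"
  then have "(\<phi> f, y) \<in> (steps (\<phi> ` F) c' t')\<^sup>*" by simp
  then have "y \<in> \<phi> ` (F \<inter> (steps F c t)\<^sup>* `` {f})"
  proof (rule rtrancl_steps_closed)
    fix z assume "z \<in> \<phi> ` (F \<inter> (steps F c t)\<^sup>* `` {f})"
    then obtain x where x: "z = \<phi> x" "x \<in> F" "(f, x) \<in> (steps F c t)\<^sup>*" by auto
    have "c' z = \<phi> (c x)" "t' z = \<phi> (t x)"
      using x assms by auto
    moreover have "c x \<in> F \<inter> (steps F c t)\<^sup>* `` {f}" "t x \<in> F \<inter> (steps F c t)\<^sup>* `` {f}"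
      using x assms rtrancl_stepsI[of f x F c t] by auto
    ultimately show "c' z \<in> \<phi> ` (F \<inter> (steps F c t)\<^sup>* `` {f})"
      "t' z \<in> \<phi> ` (F \<inter> (steps F c t)\<^sup>* `` {f})" by auto
  qed (use assms in auto)
  then show "y \<in> \<phi> ` ((steps F c t)\<^sup>* `` {f})" by auto
next
  fix y assume "y \<in> \<phi> ` ((steps F c t)\<^sup>* `` {f})"
  then obtain x where x: "y = \<phi> x" "(f, x) \<in> (steps F c t)\<^sup>*" by auto
  have "x \<in> {x \<in> F. (\<phi> f, \<phi> x) \<in> (steps (\<phi> ` F) c' t')\<^sup>*}"
  proof (rule rtrancl_steps_closed[OF x(2)])
    fix z assume "z \<in> {x \<in> F. (\<phi> f, \<phi> x) \<in> (steps (\<phi> ` F) c' t')\<^sup>*}"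
    then show "c z \<in> {x \<in> F. (\<phi> f, \<phi> x) \<in> (steps (\<phi> ` F) c' t')\<^sup>*}"
      "t z \<in> {x \<in> F. (\<phi> f, \<phi> x) \<in> (steps (\<phi> ` F) c' t')\<^sup>*}"
      using assms rtrancl_stepsI[of "\<phi> f" "\<phi> z" "\<phi> ` F" c' t'] by auto
  qed (use assms in auto)
  then show "y \<in> (steps (\<phi> ` F) c' t')\<^sup>* `` {\<phi> f}" using x by simp
qed

lemma orbits_image:
  assumes "c ` F \<subseteq> F" "t ` F \<subseteq> F"
    and "\<And>x. x \<in> F \<Longrightarrow> c' (\<phi> x) = \<phi> (c x)" "\<And>x. x \<in> F \<Longrightarrow> t' (\<phi> x) = \<phi> (t x)"
  shows "orbits (\<phi> ` F) c' t' = (`) \<phi> ` orbits F c t"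
proof -
  have "(steps (\<phi> ` F) c' t')\<^sup>* `` {\<phi> x} = \<phi> ` ((steps F c t)\<^sup>* `` {x})" if "x \<in> F" for x
    using orbit_image[OF that assms] .
  then show ?thesis unfolding orbits_def quotient_def by auto
qed

lemma orbits_cong:
  assumes "c ` F \<subseteq> F" "t ` F \<subseteq> F"
    and "\<And>x. x \<in> F \<Longrightarrow> c' x = c x" "\<And>x. x \<in> F \<Longrightarrow> t' x = t x"
  shows "orbits F c' t' = orbits F c t"
  using orbits_image[where \<phi> = "\<lambda>x. x", OF assms] by simp

lemma orbits_subset_Pow:
  assumes "c ` F \<subseteq> F" "t ` F \<subseteq> F"
  shows "orbits F c t \<subseteq> Pow F"
proof -
  have "y \<in> F" if "x \<in> F" "(x, y) \<in> (steps F c t)\<^sup>*" for x y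
    by (rule rtrancl_steps_closed[OF that(2)]) (use assms that in auto)
  then show ?thesis unfolding orbits_def quotient_def by auto
qed

text \<open>
  Removing from the orbits a set \<open>e\<close> that is invariant under \<open>t\<close>: the involution \<open>c\<close> is replaced by
  its first return to the complement of \<open>e\<close>, along an excursion alternating between \<open>c\<close> and \<open>t\<close>.
\<close>

locale excursion =
  fixes F e :: "'a set" and c t :: "'a \<Rightarrow> 'a"
  assumes finite_F: "finite F"
    and c: "free_involution_on F c"
    and t: "free_involution_on F t"
    and e: "e \<subseteq> F" "t ` e \<subseteq> e"
begin

text \<open>The same expressions as in the corner map of \<open>excise\<close>, with
  \<open>t\<close> for \<open>cross G A\<close>: the excursion starts with \<open>c\<close>, and
  each further step is \<open>t\<close> followed by \<open>c\<close>.\<close>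

definition follow :: "'a \<Rightarrow> nat \<Rightarrow> 'a" where
  "follow f n = ((c \<circ> t) ^^ n) (c f)"

definition exit_time :: "'a \<Rightarrow> nat" where
  "exit_time f = (LEAST n. follow f n \<notin> e)"

definition return_map :: "'a \<Rightarrow> 'a" where
  "return_map f = follow f (exit_time f)"

lemma follow_simps [simp]: "follow f 0 = c f" "follow f (Suc n) = c (t (follow f n))"
  by (simp_all add: follow_def)

lemma invol [simp]:
  assumes "f \<in> F"
  shows "c f \<in> F" "c f \<noteq> f" "f \<noteq> c f" "c (c f) = f" "t f \<in> F" "t f \<noteq> f" "f \<noteq> t f" "t (t f) = f"
  using free_involution_onD[OF c assms] free_involution_onD[OF t assms] by auto

lemma follow_in [simp]: "f \<in> F \<Longrightarrow> follow f n \<in> F"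
  by (induction n) auto

lemma t_mem_e_iff: "f \<in> F \<Longrightarrow> t f \<in> e \<longleftrightarrow> f \<in> e"
  using e(2) invol(8)[of f] by (metis image_subset_iff)

text \<open>An excursion confined to \<open>e\<close> would be an injective sequence in the finite
  set \<open>F\<close>: a repetition could be cancelled back, \<open>c\<close> and \<open>t\<close>
  being injective, to \<open>f = t (follow f k)\<close>, which lies in \<open>e\<close> while
  \<open>f\<close> does not.\<close>

lemma follow_exits:
  assumes f: "f \<in> F - e"
  shows "\<exists>n. follow f n \<notin> e"
proof (rule ccontr)
  assume "\<nexists>n. follow f n \<notin> e"
  then have in_e: "follow f n \<in> e" for n by blast
  have no_return: "follow f i \<noteq> follow f (Suc (i + k))" for i k
  proof (induction i)
    case 0
    show ?case
    proof
      assume "follow f 0 = follow f (Suc (0 + k))"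
      then have "c (c f) = c (c (t (follow f k)))" by simp
      then have "f = t (follow f k)" using f by simp
      then show False using f in_e t_mem_e_iff[of "follow f k"] by auto
    qed
  next
    case (Suc i)
    show ?case
    proof
      assume "follow f (Suc i) = follow f (Suc (Suc i + k))"
      then have "t (c (c (t (follow f i)))) = t (c (c (t (follow f (Suc (i + k))))))"
        by (simp del: follow_simps(2) add: follow_simps(2)[of f i] follow_simps(2)[of f "Suc (i + k)"])
      then have "follow f i = follow f (Suc (i + k))" using f by (simp del: follow_simps)
      then show False using Suc by blast
    qed
  qed
  have "inj (follow f)"
  proof (rule linorder_injI)
    fix i j :: nat assume "i < j"
    then obtain k where "j = Suc (i + k)" using less_iff_Suc_add by auto
    then show "follow f i \<noteq> follow f j" using no_return by auto
  qed
  moreover have "finite (range (follow f))"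
    by (rule finite_subset[OF _ finite_F]) (use f in auto)
  ultimately show False using finite_imageD by blast
qed

lemma exit_time:
  assumes "f \<in> F - e"
  shows "follow f (exit_time f) \<notin> e" "n < exit_time f \<Longrightarrow> follow f n \<in> e"
  using LeastI_ex[OF follow_exits[OF assms]] not_less_Least[of n "\<lambda>n. follow f n \<notin> e"]
  by (auto simp: exit_time_def)

lemma return_map_in:
  assumes "f \<in> F - e"
  shows "return_map f \<in> F - e"
  using assms exit_time[OF assms] by (simp add: return_map_def)

text \<open>The excursion starting from the return point runs backwards along the original one.\<close>

lemma follow_return_map:
  assumes f: "f \<in> F - e"
  shows "k < exit_time f \<Longrightarrow> follow (return_map f) k = t (follow f (exit_time f - Suc k))"
    and "k = exit_time f \<Longrightarrow> follow (return_map f) k = f"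
proof -
  let ?N = "exit_time f"
  have *: "follow (return_map f) k = t (follow f (?N - Suc k))" if "k < ?N" for k
    using that
  proof (induction k)
    case 0
    then obtain m where "?N = Suc m" by (cases ?N) auto
    then show ?case using f by (simp add: return_map_def)
  next
    case (Suc k)
    then obtain m where "?N - Suc k = Suc m" by (cases "?N - Suc k") auto
    moreover from this have "?N - Suc (Suc k) = m" by simp
    ultimately show ?case using Suc f by simp
  qed
  show "k < ?N \<Longrightarrow> follow (return_map f) k = t (follow f (?N - Suc k))" by (rule *)
  assume k: "k = ?N"
  show "follow (return_map f) k = f"
  proof (cases k)
    case 0
    then show ?thesis using k f by (simp add: return_map_def)
  next
    case (Suc m)
    then show ?thesis using *[of m] k f by simp
  qed
qed

text \<open>The reversed excursion stays in \<open>e\<close> before time \<open>exit_time f\<close>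
  and then reaches \<open>f\<close>, so both exit times coincide.\<close>

lemma return_map_return_map:
  assumes f: "f \<in> F - e"
  shows "return_map (return_map f) = f"
proof -
  have "exit_time (return_map f) = exit_time f"
    unfolding exit_time_def[of "return_map f"]
  proof (rule Least_equality)
    show "follow (return_map f) (exit_time f) \<notin> e"
      using follow_return_map(2)[OF f] f by simp
  next
    fix k assume k: "follow (return_map f) k \<notin> e"
    show "exit_time f \<le> k"
    proof (rule ccontr)
      assume "\<not> exit_time f \<le> k"
      then have "k < exit_time f" by simp
      moreover from this have "follow f (exit_time f - Suc k) \<in> e"
        by (intro exit_time[OF f]) simp
      ultimately have "follow (return_map f) k \<in> e"
        using follow_return_map(1)[OF f, of k] f t_mem_e_iff by simp
      then show False using k by simp
    qed
  qed
  then show ?thesis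
    using follow_return_map(2)[OF f refl] unfolding return_map_def by simp
qed

text \<open>
  A closed excursion would be a palindrome in \<open>c\<close> and \<open>t\<close> of odd length, whose middle letter would
  have a fixed point.
\<close>

lemma return_map_neq:
  assumes f: "f \<in> F - e"
  shows "return_map f \<noteq> f"
proof
  assume eq: "return_map f = f"
  let ?N = "exit_time f"
  \<comment> \<open>The parity of the excursion length locates the middle letter: it is
    \<open>t\<close> for odd \<open>?N\<close> and \<open>c\<close> for even \<open>?N\<close>,
    including \<open>?N = 0\<close>, where \<open>c f = f\<close>.\<close>
  consider "?N = 0" | m where "?N = Suc (2 * m)" | m where "?N = 2 * Suc m"
    by (metis evenE oddE Suc_eq_plus1 not0_implies_Suc mult_0_right)
  then show False
  proof cases
    case 1
    then show False using eq f by (simp add: return_map_def)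
  next
    case 2
    then have "follow f m = t (follow f m)"
      using follow_return_map(1)[OF f, of m] eq by simp
    then show False using f by simp
  next
    case 3
    then have "follow f (Suc m) = t (follow f m)"
      using follow_return_map(1)[OF f, of "Suc m"] eq by simp
    then have "c (t (follow f m)) = t (follow f m)" by simp
    then show False using f by (simp del: follow_simps)
  qed
qed

lemma free_involution_return_map: "free_involution_on (F - e) return_map"
  using return_map_in return_map_return_map return_map_neq by (auto simp: free_involution_on_def)

text \<open>\<open>t\<close> determines the excursions, \<open>t'\<close> the orbits to be counted.
  For ribbon graphs they are the crossing maps of \<open>A\<close> and of
  \<open>B \<union> A\<close>, which can differ only off \<open>e\<close>.\<close>

context
  fixes t' :: "'a \<Rightarrow> 'a"
  assumes t': "free_involution_on F t'" and agree: "\<And>f. f \<in> e \<Longrightarrow> t' f = t f"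
begin

lemma t'_mem_e_iff: "f \<in> F \<Longrightarrow> t' f \<in> e \<longleftrightarrow> f \<in> e"
  using e agree free_involution_onD[OF t', of f] by (metis image_subset_iff)

lemma free_involution_diff: "free_involution_on (F - e) t'"
  using t' t'_mem_e_iff by (auto simp: free_involution_on_def)

text \<open>A return step is a path of \<open>c\<close> and \<open>t'\<close> steps, as
  \<open>t'\<close> agrees with \<open>t\<close> along the excursion. The other inclusion fills the
  excursions back in.\<close>

lemma orbit_diff:
  assumes f: "f \<in> F - e"
  shows "(steps (F - e) return_map t')\<^sup>* `` {f} = (steps F c t')\<^sup>* `` {f} - e"
proof (intro equalityI subsetI)
  let ?R = "(steps F c t')\<^sup>*"
  let ?R' = "(steps (F - e) return_map t')\<^sup>*"
  fix g assume "g \<in> ?R' `` {f}"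
  then have g: "(f, g) \<in> ?R'" by simp
  have "g \<in> {g \<in> F - e. (f, g) \<in> ?R}"
  proof (rule rtrancl_steps_closed[OF g])
    fix x assume x: "x \<in> {g \<in> F - e. (f, g) \<in> ?R}"
    have "n \<le> exit_time x \<Longrightarrow> (f, follow x n) \<in> ?R" for n
    proof (induction n)
      case 0
      then show ?case using x rtrancl_stepsI(1)[of f x F c t'] by simp
    next
      case (Suc n)
      then have "(f, t' (follow x n)) \<in> ?R" "follow x n \<in> e"
        using x rtrancl_stepsI(2)[of f _ F c t'] exit_time(2)[of x n] by auto
      then show ?case
        using x agree rtrancl_stepsI(1)[of f "t (follow x n)" F c t'] by simp
    qed
    then show "return_map x \<in> {g \<in> F - e. (f, g) \<in> ?R}"
      using x return_map_in[of x] by (simp add: return_map_def)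
    show "t' x \<in> {g \<in> F - e. (f, g) \<in> ?R}"
      using x t'_mem_e_iff[of x] free_involution_onD[OF t', of x] rtrancl_stepsI(2)[of f x F c t']
      by auto
  qed (use f in auto)
  then show "g \<in> ?R `` {f} - e" by auto
next
  let ?R = "(steps F c t')\<^sup>*"
  let ?R' = "(steps (F - e) return_map t')\<^sup>*"
  \<comment> \<open>\<open>?P\<close> is the orbit under the return map; \<open>?K\<close> adds
    every excursion issuing from it, before and after each application of \<open>t\<close>.
    \<open>?K\<close> is closed under \<open>c\<close> and \<open>t'\<close>, and the added points
    lie in \<open>e\<close>.\<close>
  let ?P = "{x \<in> F - e. (f, x) \<in> ?R'}"
  let ?K = "?P \<union> {follow x n | x n. x \<in> ?P \<and> n < exit_time x}
    \<union> {t (follow x n) | x n. x \<in> ?P \<and> n < exit_time x}"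
  have P_return: "return_map x \<in> ?P" if "x \<in> ?P" for x
    using that return_map_in[of x] rtrancl_stepsI(1)[of f x "F - e" return_map t'] by auto
  have follow_K: "follow x n \<in> ?K" if "x \<in> ?P" "n \<le> exit_time x" for x n
  proof (cases "n = exit_time x")
    case True
    then show ?thesis using P_return[OF that(1)] by (simp add: return_map_def)
  next
    case False
    then have "n < exit_time x" using that by simp
    then show ?thesis using that(1) by blast
  qed
  fix g assume "g \<in> ?R `` {f} - e"
  then have g: "(f, g) \<in> ?R" "g \<notin> e" by auto
  have "g \<in> ?K"
  proof (rule rtrancl_steps_closed[OF g(1)])
    show "f \<in> ?K" using f by simp
  next
    fix x assume "x \<in> ?K"
    then consider "x \<in> ?P"
      | y n where "x = follow y n" "y \<in> ?P" "n < exit_time y"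
      | y n where "x = t (follow y n)" "y \<in> ?P" "n < exit_time y"
      by blast
    then show "c x \<in> ?K"
    proof cases
      case 1
      then show ?thesis using follow_K[of x 0] by simp
    next
      case 2
      show ?thesis
      proof (cases n)
        case 0
        then show ?thesis using 2 by simp
      next
        case (Suc m)
        then have "c x = t (follow y m)" using 2 by simp
        moreover have "m < exit_time y" using 2 Suc by simp
        ultimately show ?thesis using 2(2) by blast
      qed
    next
      case 3
      then show ?thesis using follow_K[of y "Suc n"] by simp
    qed
  next
    fix x assume "x \<in> ?K"
    then consider "x \<in> ?P"
      | y n where "x = follow y n" "y \<in> ?P" "n < exit_time y"
      | y n where "x = t (follow y n)" "y \<in> ?P" "n < exit_time y"
      by blast
    then show "t' x \<in> ?K"
    proof cases
      case 1
      then have "t' x \<in> ?P"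
        using t'_mem_e_iff[of x] free_involution_onD[OF t', of x] rtrancl_stepsI(2)[of f x "F - e"]
        by auto
      then show ?thesis by blast
    next
      case 2
      then have "follow y n \<in> e" using exit_time(2)[of y n] by auto
      then have "t' x = t (follow y n)" using agree 2 by simp
      then show ?thesis using 2 by blast
    next
      case 3
      then have "follow y n \<in> e" using exit_time(2)[of y n] by auto
      then have "t (follow y n) \<in> e" using e by auto
      then have "t' x = follow y n" using agree[of x] 3 by simp
      then show ?thesis using 3 by blast
    qed
  qed
  moreover have "follow x n \<in> e" "t (follow x n) \<in> e" if "x \<in> ?P" "n < exit_time x" for x n
    using exit_time(2)[of x n] that t_mem_e_iff by auto
  ultimately have "g \<in> ?P" using g(2) by auto
  then show "g \<in> ?R' `` {f}" by simp
qed

text \<open>Inside \<open>e\<close> the two involutions agree, so an orbit that never leaves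
  \<open>e\<close> for one of them is an orbit of the other.\<close>

lemma orbit_in_e:
  assumes "f \<in> F" "(steps F c t)\<^sup>* `` {f} \<subseteq> e \<or> (steps F c t')\<^sup>* `` {f} \<subseteq> e"
  shows "(steps F c t)\<^sup>* `` {f} = (steps F c t')\<^sup>* `` {f}"
proof -
  have *: "(steps F c s)\<^sup>* `` {f} = (steps F c s')\<^sup>* `` {f}"
    if sub: "(steps F c s)\<^sup>* `` {f} \<subseteq> e" and s: "\<And>x. x \<in> e \<Longrightarrow> s x = s' x" for s s'
  proof (intro equalityI subsetI)
    fix g assume "g \<in> (steps F c s)\<^sup>* `` {f}"
    then have "(f, g) \<in> (steps F c s)\<^sup>*" by simp
    then show "g \<in> (steps F c s')\<^sup>* `` {f}"
    proof (induction rule: rtrancl_induct)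
      case (step y z)
      then have "y \<in> e" using sub by auto
      then have "(y, z) \<in> steps F c s'" using step s by (auto simp: steps_def)
      then show ?case using step by auto
    qed simp
  next
    fix g assume "g \<in> (steps F c s')\<^sup>* `` {f}"
    then have "(f, g) \<in> (steps F c s')\<^sup>*" by simp
    then show "g \<in> (steps F c s)\<^sup>* `` {f}"
    proof (induction rule: rtrancl_induct)
      case (step y z)
      then have "y \<in> e" using sub by auto
      then have "(y, z) \<in> steps F c s" using step s by (auto simp: steps_def)
      then show ?case using step by auto
    qed simp
  qed
  show ?thesis using assms(2) *[of t t'] *[of t' t] agree by auto
qed

text \<open>Orbits leaving \<open>e\<close> correspond by \<open>C \<mapsto> C - e\<close> to orbits
  of the return map. Those inside \<open>e\<close> are the same for \<open>t\<close> and
  \<open>t'\<close>; counted with \<open>t\<close>, they match the new isolated vertices of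
  \<open>excise\<close>.\<close>

lemma card_orbits:
  "card (orbits F c t') =
     card (orbits (F - e) return_map t') + card {C \<in> orbits F c t. C \<subseteq> e}"
proof -
  let ?R = "(steps F c t')\<^sup>*"
  let ?In = "{C \<in> orbits F c t'. C \<subseteq> e}" and ?Out = "{C \<in> orbits F c t'. \<not> C \<subseteq> e}"
  have eq: "equiv UNIV ?R" using equiv_steps[OF c t'] .
  have "finite (orbits F c t')"
    by (simp add: orbits_def quotient_def finite_F)
  then have "card (orbits F c t') = card ?In + card ?Out"
    by (subst card_Un_disjoint[symmetric]) (auto intro!: arg_cong[where f = card])
  moreover have "?In = {C \<in> orbits F c t. C \<subseteq> e}"
    unfolding orbits_def quotient_def using orbit_in_e by blast
  moreover have "card ?Out = card (orbits (F - e) return_map t')"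
  proof (rule bij_betw_same_card[where f = "\<lambda>C. C - e"], rule bij_betw_imageI)
    show "inj_on (\<lambda>C. C - e) ?Out"
    proof (rule inj_onI)
      fix C D assume CD: "C \<in> ?Out" "D \<in> ?Out" "C - e = D - e"
      then obtain x where "x \<in> C \<inter> D" by auto
      moreover have "C \<in> UNIV // ?R" "D \<in> UNIV // ?R"
        using CD by (auto simp: orbits_def quotient_def)
      ultimately show "C = D" using quotient_disj[OF eq] by blast
    qed
    show "(\<lambda>C. C - e) ` ?Out = orbits (F - e) return_map t'"
    proof (intro equalityI subsetI)
      fix D assume "D \<in> (\<lambda>C. C - e) ` ?Out"
      then obtain f where f: "f \<in> F" "D = ?R `` {f} - e" "\<not> ?R `` {f} \<subseteq> e"
        by (auto simp: orbits_def quotient_def)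
      then obtain x where x: "(f, x) \<in> ?R" "x \<notin> e" by auto
      have "x \<in> F"
        by (rule rtrancl_steps_closed[OF x(1)]) (use f free_involution_onD[OF t'] in auto)
      moreover have "?R `` {x} = ?R `` {f}"
        using eq x(1) equiv_class_eq by fastforce
      ultimately have "D = (steps (F - e) return_map t')\<^sup>* `` {x}"
        using orbit_diff[of x] x f by auto
      then show "D \<in> orbits (F - e) return_map t'"
        using \<open>x \<in> F\<close> x by (auto simp: orbits_def quotient_def)
    next
      fix D assume "D \<in> orbits (F - e) return_map t'"
      then obtain f where f: "f \<in> F - e" "D = (steps (F - e) return_map t')\<^sup>* `` {f}"
        by (auto simp: orbits_def quotient_def)
      then have "D = ?R `` {f} - e" "?R `` {f} \<in> ?Out"
        using orbit_diff[of f] by (auto simp: orbits_def quotient_def)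
      then show "D \<in> (\<lambda>C. C - e) ` ?Out" by blast
    qed
  qed
  ultimately show ?thesis by simp
qed

end

end

section \<open>Deletion and contraction\<close>

definition edge_of :: "'a ribbon \<Rightarrow> 'a \<Rightarrow> 'a set" where
  "edge_of G f = {f, seg G f, side G f, seg G (side G f)}"

lemma edges_eq_edge_of: "edges G = edge_of G ` flags G"
  by (simp add: edges_def edge_of_def)

lemma boundary_circles_eq_orbits:
  "boundary_circles G A = orbits (flags G) (corner G) (cross G A)"
  by (simp add: boundary_circles_def orbits_def boundary_step_def steps_def)

text \<open>This expresses all of \<open>rho\<close> except \<open>card A\<close> by
  \<open>num_boundary\<close>, the one count to be traced through minors.\<close>

lemma num_vertices_eq: "num_vertices G = num_boundary G {}"
  by (simp add: num_vertices_def vertices_def num_boundary_def)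

lemma ribbon_graphD:
  assumes "ribbon_graph G" "f \<in> flags G"
  shows "seg G f \<in> flags G" "side G f \<in> flags G" "corner G f \<in> flags G"
    "seg G f \<noteq> f" "side G f \<noteq> f" "corner G f \<noteq> f"
    "seg G (seg G f) = f" "side G (side G f) = f" "corner G (corner G f) = f"
    "side G (seg G f) = seg G (side G f)" "seg G f \<noteq> side G f"
  using assms by (auto simp: ribbon_graph_def free_involution_on_def)

lemma finite_edges: "ribbon_graph G \<Longrightarrow> finite (edges G)"
  by (simp add: edges_def ribbon_graph_def)

text \<open>\<open>seg\<close> and \<open>side\<close> commute, so an edge is an orbit of the
  four-group they generate and can be recovered from any of its flags.\<close>

lemma edge_of_eq:
  assumes "ribbon_graph G" "f \<in> flags G" "g \<in> edge_of G f"
  shows "g \<in> flags G" "edge_of G g = edge_of G f"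
proof -
  note f = ribbon_graphD[OF assms(1,2)]
  have s: "seg G (seg G (side G f)) = side G f" "side G (seg G (side G f)) = seg G f"
    "seg G (side G f) \<in> flags G"
    using ribbon_graphD[OF assms(1) f(2)] f(8) by metis+
  consider "g = f" | "g = seg G f" | "g = side G f" | "g = seg G (side G f)"
    using assms(3) by (auto simp: edge_of_def)
  then show "g \<in> flags G" "edge_of G g = edge_of G f"
    using assms(2) f(1,2,7,8,10) s by (cases; simp add: edge_of_def insert_commute)+
qed

lemma edgeD:
  assumes "ribbon_graph G" "e \<in> edges G" "f \<in> e"
  shows "f \<in> flags G" "e = edge_of G f"
proof -
  obtain x where x: "x \<in> flags G" "e = edge_of G x"
    using assms(2) by (auto simp: edges_eq_edge_of)
  show "f \<in> flags G" "e = edge_of G f"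
    using edge_of_eq[OF assms(1) x(1), of f] assms(3) x(2) by simp_all
qed

lemma seg_side_in_edge:
  assumes "ribbon_graph G" "e \<in> edges G" "f \<in> e"
  shows "seg G f \<in> e" "side G f \<in> e"
proof -
  have "{seg G f, side G f} \<subseteq> edge_of G f" by (simp add: edge_of_def)
  then show "seg G f \<in> e" "side G f \<in> e" using edgeD(2)[OF assms] by simp_all
qed

lemma mem_Union_edges_iff:
  assumes "ribbon_graph G" "A \<subseteq> edges G" "f \<in> flags G"
  shows "f \<in> \<Union>A \<longleftrightarrow> edge_of G f \<in> A"
proof
  assume "f \<in> \<Union>A"
  then obtain e where "e \<in> A" "f \<in> e" by blast
  then show "edge_of G f \<in> A" using edgeD(2)[OF assms(1), of e f] assms(2) by auto
next
  assume "edge_of G f \<in> A"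
  then show "f \<in> \<Union>A" by (auto simp: edge_of_def)
qed

text \<open>Neither \<open>seg\<close> nor \<open>side\<close> leaves an edge, so a flag and its
  crossing partner use the same branch of \<open>cross\<close>.\<close>

lemma free_involution_cross:
  assumes G: "ribbon_graph G" and A: "A \<subseteq> edges G"
  shows "free_involution_on (flags G) (cross G A)"
  unfolding free_involution_on_def
proof (intro ballI)
  fix f assume f: "f \<in> flags G"
  have "{seg G f, side G f} \<subseteq> edge_of G f" by (simp add: edge_of_def)
  then have "edge_of G (seg G f) = edge_of G f" "edge_of G (side G f) = edge_of G f"
    using edge_of_eq(2)[OF G f] by blast+
  then have "seg G f \<in> \<Union>A \<longleftrightarrow> f \<in> \<Union>A" "side G f \<in> \<Union>A \<longleftrightarrow> f \<in> \<Union>A"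
    using mem_Union_edges_iff[OF G A] f ribbon_graphD[OF G f] by metis+
  then show "cross G A f \<in> flags G \<and> cross G A f \<noteq> f \<and> cross G A (cross G A f) = f"
    using ribbon_graphD[OF G f] unfolding cross_def by presburger
qed

lemma excursion_edge:
  assumes G: "ribbon_graph G" and e: "e \<in> edges G" and A: "A \<subseteq> edges G"
  shows "excursion (flags G) e (corner G) (cross G A)"
proof
  show "finite (flags G)" "free_involution_on (flags G) (corner G)"
    using G by (auto simp: ribbon_graph_def)
  show "free_involution_on (flags G) (cross G A)"
    using free_involution_cross[OF G A] .
  show "e \<subseteq> flags G" using edgeD[OF G e] by auto
  show "cross G A ` e \<subseteq> e"
    using seg_side_in_edge[OF G e] by (auto simp: cross_def)
qed

section \<open>Excising one edge\<close>

lemma excise_simps [simp]: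
  "flags (excise G e A) = flags G - e"
  "seg (excise G e A) = seg G"
  "side (excise G e A) = side G"
  "isolated (excise G e A) = isolated G + card {C \<in> boundary_circles G A. C \<subseteq> e}"
  by (simp_all add: excise_def)

lemma corner_excise:
  assumes "excursion (flags G) e (corner G) (cross G A)"
  shows "corner (excise G e A) = excursion.return_map e (corner G) (cross G A)"
  by (rule ext) (simp add: excise_def Let_def excursion.return_map_def[OF assms]
      excursion.exit_time_def[OF assms] excursion.follow_def[OF assms])

lemma ribbon_graph_excise:
  assumes G: "ribbon_graph G" and e: "e \<in> edges G" and A: "A \<subseteq> edges G"
  shows "ribbon_graph (excise G e A)"
proof -
  note ex = excursion_edge[OF G e A]
  have "seg G f \<notin> e \<and> side G f \<notin> e" if "f \<in> flags G" "f \<notin> e" for f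
    using seg_side_in_edge[OF G e] ribbon_graphD[OF G that(1)] that(2) by metis
  then show ?thesis
    using ribbon_graphD[OF G] G excursion.free_involution_return_map[OF ex]
    by (simp add: ribbon_graph_def corner_excise[OF ex] free_involution_on_def)
qed

lemma edges_excise:
  assumes G: "ribbon_graph G" and e: "e \<in> edges G"
  shows "edges (excise G e A) = edges G - {e}"
proof -
  have "edge_of (excise G e A) = edge_of G"
    by (simp add: edge_of_def fun_eq_iff)
  moreover have "edge_of G f = e \<longleftrightarrow> f \<in> e" if "f \<in> flags G" for f
    using edgeD(2)[OF G e, of f] by (auto simp: edge_of_def)
  ultimately show ?thesis by (auto simp: edges_eq_edge_of)
qed

text \<open>An instance of \<open>excursion.card_orbits\<close> with \<open>t = cross G A\<close>
  and \<open>t' = cross G (B \<union> A)\<close>: circles meeting the remaining flags are shortened,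
  circles inside \<open>e\<close> become isolated vertices, and none is lost. Taking
  \<open>A\<close> empty gives deletion, \<open>A = {e}\<close> contraction.\<close>

lemma num_boundary_excise:
  assumes G: "ribbon_graph G" and e: "e \<in> edges G" and A: "A \<subseteq> {e}" and B: "B \<subseteq> edges G - {e}"
  shows "num_boundary (excise G e A) B = num_boundary G (B \<union> A)"
proof -
  have A': "A \<subseteq> edges G" and BA: "B \<union> A \<subseteq> edges G" using e A B by auto
  note ex = excursion_edge[OF G e A']
  note inv = free_involution_cross[OF G BA]
  have agree: "cross G (B \<union> A) f = cross G A f" if "f \<in> e" for f
  proof -
    have "f \<in> flags G" "edge_of G f = e" using edgeD[OF G e that] by auto
    then have "f \<in> \<Union>(B \<union> A) \<longleftrightarrow> f \<in> \<Union>A"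
      using mem_Union_edges_iff[OF G] A' BA B by blast
    then show ?thesis by (simp add: cross_def)
  qed
  \<comment> \<open>The edges in \<open>A\<close> cover no flag off \<open>e\<close>.\<close>
  have "cross (excise G e A) B f = cross G (B \<union> A) f" if "f \<in> flags G - e" for f
    using that A by (auto simp: cross_def)
  moreover have "excursion.return_map e (corner G) (cross G A) ` (flags G - e) \<subseteq> flags G - e"
    using excursion.return_map_in[OF ex] by blast
  moreover have "cross G (B \<union> A) ` (flags G - e) \<subseteq> flags G - e"
    using excursion.free_involution_diff[OF ex inv agree] by (auto simp: free_involution_on_def)
  ultimately have "boundary_circles (excise G e A) B =
      orbits (flags G - e) (excursion.return_map e (corner G) (cross G A)) (cross G (B \<union> A))"
    unfolding boundary_circles_eq_orbits corner_excise[OF ex] excise_simps by (intro orbits_cong) auto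
  then show ?thesis
    using excursion.card_orbits[OF ex inv agree]
    by (simp add: num_boundary_def boundary_circles_eq_orbits)
qed

lemmas ribbon_graph_delete = ribbon_graph_excise[where A = "{}", folded delete_def, simplified]

lemma ribbon_graph_contract:
  "ribbon_graph G \<Longrightarrow> e \<in> edges G \<Longrightarrow> ribbon_graph (contract G e)"
  unfolding contract_def by (rule ribbon_graph_excise) auto

lemma edges_delete: "ribbon_graph G \<Longrightarrow> e \<in> edges G \<Longrightarrow> edges (delete G e) = edges G - {e}"
  unfolding delete_def by (rule edges_excise)

lemma edges_contract: "ribbon_graph G \<Longrightarrow> e \<in> edges G \<Longrightarrow> edges (contract G e) = edges G - {e}"
  unfolding contract_def by (rule edges_excise)

lemma num_boundary_delete:
  assumes "ribbon_graph G" "e \<in> edges G" "B \<subseteq> edges G - {e}"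
  shows "num_boundary (delete G e) B = num_boundary G B"
  using num_boundary_excise[OF assms(1,2) _ assms(3), of "{}"] by (simp add: delete_def)

lemma num_boundary_contract:
  assumes "ribbon_graph G" "e \<in> edges G" "B \<subseteq> edges G - {e}"
  shows "num_boundary (contract G e) B = num_boundary G (insert e B)"
  using num_boundary_excise[OF assms(1,2) _ assms(3), of "{e}"] by (simp add: contract_def)

section \<open>Deleting or contracting several edges\<close>

lemma delete_list:
  assumes "ribbon_graph G" "distinct es" "set es \<subseteq> edges G"
  shows "ribbon_graph (delete_list G es)" "edges (delete_list G es) = edges G - set es"
    and "B \<subseteq> edges G - set es \<Longrightarrow> num_boundary (delete_list G es) B = num_boundary G B"
  using assms
proof (induction es arbitrary: G)
  case (Cons e es)
  {
    case 1
    then show ?case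
      using Cons.IH(1)[of "delete G e"] ribbon_graph_delete[of G e] edges_delete[of G e]
      by (auto simp: delete_list_def)
  next
    case 2
    then show ?case
      using Cons.IH(2)[of "delete G e"] ribbon_graph_delete[of G e] edges_delete[of G e]
      by (auto simp: delete_list_def)
  next
    case 3
    then have "num_boundary (delete_list G (e # es)) B = num_boundary (delete G e) B"
      using Cons.IH(3)[of "delete G e"] ribbon_graph_delete[of G e] edges_delete[of G e]
      by (auto simp: delete_list_def)
    also have "\<dots> = num_boundary G B" using 3 by (intro num_boundary_delete) auto
    finally show ?case .
  }
qed (simp_all add: delete_list_def)

lemma contract_list:
  assumes "ribbon_graph G" "distinct es" "set es \<subseteq> edges G"
  shows "ribbon_graph (contract_list G es)" "edges (contract_list G es) = edges G - set es"
    and "B \<subseteq> edges G - set es \<Longrightarrow> num_boundary (contract_list G es) B = num_boundary G (B \<union> set es)"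
  using assms
proof (induction es arbitrary: G)
  case (Cons e es)
  {
    case 1
    then show ?case
      using Cons.IH(1)[of "contract G e"] ribbon_graph_contract[of G e] edges_contract[of G e]
      by (auto simp: contract_list_def)
  next
    case 2
    then show ?case
      using Cons.IH(2)[of "contract G e"] ribbon_graph_contract[of G e] edges_contract[of G e]
      by (auto simp: contract_list_def)
  next
    case 3
    then have "num_boundary (contract_list G (e # es)) B = num_boundary (contract G e) (B \<union> set es)"
      using Cons.IH(3)[of "contract G e"] ribbon_graph_contract[of G e] edges_contract[of G e]
      by (auto simp: contract_list_def)
    also have "\<dots> = num_boundary G (B \<union> set (e # es))"
      using 3 by (subst num_boundary_contract) auto
    finally show ?case .
  }
qed (simp_all add: contract_list_def)

section \<open>Edge types\<close>

text \<open>Rank plus half the Euler genus of the one-edge graph: a bridge has rank 1, an annulus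
  contributes nothing, and a Moebius band has Euler genus 1.\<close>

fun type_rank :: "edge_type \<Rightarrow> rat" where
  "type_rank BB = 1"
| "type_rank OL = 0"
| "type_rank NL = 1/2"

lemma remove_isolated_simps [simp]:
  "flags (remove_isolated G) = flags G" "seg (remove_isolated G) = seg G"
  "side (remove_isolated G) = side G" "corner (remove_isolated G) = corner G"
  "isolated (remove_isolated G) = 0" "edges (remove_isolated G) = edges G"
  "boundary_circles (remove_isolated G) A = boundary_circles G A"
  "ribbon_graph (remove_isolated G) = ribbon_graph G"
  by (simp_all add: remove_isolated_def edges_def boundary_circles_def boundary_step_def cross_def
      ribbon_graph_def cong: if_cong)

text \<open>An isolated vertex adds one to both the vertex count and the boundary count, and these
  cancel.\<close>

lemma rho_remove_isolated: "rho (remove_isolated G) A = rho G A"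
  by (simp add: rho_def num_boundary_def num_vertices_def vertices_def)

text \<open>Tailored to one-edge graphs, where every point of an orbit is reached from
  \<open>f\<close> by at most one \<open>t\<close> step followed by at most one \<open>c\<close>
  step.\<close>

lemma orbitI:
  assumes "K \<subseteq> F" "f \<in> K" "\<And>x. x \<in> K \<Longrightarrow> c x \<in> K \<and> t x \<in> K"
    and "\<And>x. x \<in> K \<Longrightarrow> x = f \<or> x = c f \<or> x = t f \<or> x = c (t f)"
  shows "(steps F c t)\<^sup>* `` {f} = K"
proof (intro equalityI subsetI)
  fix x assume "x \<in> (steps F c t)\<^sup>* `` {f}"
  then have "(f, x) \<in> (steps F c t)\<^sup>*" by simp
  then show "x \<in> K" by (rule rtrancl_steps_closed) (use assms in auto)
next
  fix x assume "x \<in> K"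
  have "c f \<in> F" "t f \<in> F" "f \<in> F" using assms by auto
  then show "x \<in> (steps F c t)\<^sup>* `` {f}"
    using assms(4)[OF \<open>x \<in> K\<close>] rtrancl_stepsI[of f f F c t] rtrancl_stepsI[of f "t f" F c t] by auto
qed

lemma is_one_edge_graph_iff:
  assumes "edges G = {e}" "isolated G = 0"
  shows "is_one_edge_graph G i \<longleftrightarrow>
    (case i of BB \<Rightarrow> card (vertices G) = 2
     | OL \<Rightarrow> card (vertices G) = 1 \<and> orientable G
     | NL \<Rightarrow> card (vertices G) = 1 \<and> \<not> orientable G)"
  using assms by (cases i) (auto simp: num_vertices_def card_2_iff card_1_singleton_iff)

text \<open>Once \<open>seg\<close> and \<open>side\<close> are given on the four flags, only the
  corner involution varies. It coincides with \<open>seg\<close>, with \<open>side\<close> or with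
  their composition, which gives b, ol and nl respectively.\<close>

lemma one_edge_graph:
  assumes G: "ribbon_graph G" and e: "edges G = {e}" and isolated: "isolated G = 0"
  obtains j where "\<And>i. is_one_edge_graph G i \<longleftrightarrow> i = j" "rho G {e} = type_rank j"
proof -
  obtain f where f: "f \<in> flags G" "e = edge_of G f"
    using e by (metis edges_eq_edge_of imageE insertI1)
  have "edge_of G x = e" if "x \<in> flags G" for x
    using e that by (metis edges_eq_edge_of imageI singletonD)
  then have "flags G \<subseteq> e" by (auto simp: edge_of_def)
  then have flags: "flags G = edge_of G f" using f edge_of_eq[OF G f(1)] by blast
  define p q r where pqr: "p = seg G f" "q = side G f" "r = seg G (side G f)"
  note rules = ribbon_graphD[OF G]
  have F: "flags G = {f, p, q, r}" using flags pqr by (simp add: edge_of_def)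
  have seg: "seg G f = p" "seg G p = f" "seg G q = r" "seg G r = q"
    and side: "side G f = q" "side G q = f" "side G p = r" "side G r = p"
    using rules[of f] rules[of p] rules[of q] f pqr by auto
  have "distinct [f, p, q, r]"
    using rules[of f] rules[of q] f(1) seg side F by auto
  then have neq: "f \<noteq> p" "p \<noteq> f" "f \<noteq> q" "q \<noteq> f" "f \<noteq> r" "r \<noteq> f" "p \<noteq> q" "q \<noteq> p" "p \<noteq> r"
    "r \<noteq> p" "q \<noteq> r" "r \<noteq> q" by auto
  have cross: "cross G {} = seg G" by (simp add: cross_def fun_eq_iff)
  have "cross G {e} x = side G x" if "x \<in> flags G" for x
    using that flags f by (simp add: cross_def)
  then have steps: "steps (flags G) (corner G) (cross G {e}) = steps (flags G) (corner G) (side G)"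
    unfolding steps_def by auto
  have circles:
    "boundary_circles G {} = (\<lambda>x. (steps {f, p, q, r} (corner G) (seg G))\<^sup>* `` {x}) ` {f, p, q, r}"
    "boundary_circles G {e} = (\<lambda>x. (steps {f, p, q, r} (corner G) (side G))\<^sup>* `` {x}) ` {f, p, q, r}"
    unfolding boundary_circles_eq_orbits orbits_def cross steps quotient_def
    unfolding F by (rule UNION_singleton_eq_range)+
  have corner_f: "corner G f \<in> {p, q, r}" using rules[of f] F by auto
  have corner_in: "corner G x \<in> {f, p, q, r} - {x} \<and> corner G (corner G x) = x" if "x \<in> {f, p, q, r}" for x
    using rules[of x] F that by auto
  \<comment> \<open>The three perfect matchings of the flags \<open>f\<close>, \<open>p\<close>,
    \<open>q\<close>, \<open>r\<close>, sorted by the partner of \<open>f\<close>.\<close>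
  consider (seg) "corner G f = p" "corner G p = f" "corner G q = r" "corner G r = q"
    | (side) "corner G f = q" "corner G q = f" "corner G p = r" "corner G r = p"
    | (opp) "corner G f = r" "corner G r = f" "corner G p = q" "corner G q = p"
    using corner_f corner_in[of f] corner_in[of p] corner_in[of q] corner_in[of r] neq by (smt (verit) Diff_iff insert_iff empty_iff)
  then show thesis
  proof cases
    case c: seg
    have "(steps {f, p, q, r} (corner G) (seg G))\<^sup>* `` {x} = {f, p}" if "x = f \<or> x = p" for x
      by (rule orbitI) (use that c seg in auto)
    moreover have "(steps {f, p, q, r} (corner G) (seg G))\<^sup>* `` {x} = {q, r}" if "x = q \<or> x = r" for x
      by (rule orbitI) (use that c seg in auto)
    ultimately have V: "boundary_circles G {} = {{f, p}, {q, r}}"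
      unfolding circles by auto
    have "(steps {f, p, q, r} (corner G) (side G))\<^sup>* `` {x} = {f, p, q, r}" if "x \<in> {f, p, q, r}" for x
      by (rule orbitI) (use that c side in auto)
    then have B: "boundary_circles G {e} = {{f, p, q, r}}"
      unfolding circles by auto
    have "card {{f, p}, {q, r}} = 2" using neq by (simp add: doubleton_eq_iff)
    then show thesis
      using isolated is_one_edge_graph_iff[OF e isolated] V B
      by (intro that[of BB])
        (simp_all add: rho_def num_vertices_def vertices_def num_boundary_def split: edge_type.split)
  next
    case c: side
    have "(steps {f, p, q, r} (corner G) (side G))\<^sup>* `` {x} = {f, q}" if "x = f \<or> x = q" for x
      by (rule orbitI) (use that c side in auto)
    moreover have "(steps {f, p, q, r} (corner G) (side G))\<^sup>* `` {x} = {p, r}" if "x = p \<or> x = r" for x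
      by (rule orbitI) (use that c side in auto)
    ultimately have B: "boundary_circles G {e} = {{f, q}, {p, r}}"
      unfolding circles by auto
    have "(steps {f, p, q, r} (corner G) (seg G))\<^sup>* `` {x} = {f, p, q, r}" if "x \<in> {f, p, q, r}" for x
      by (rule orbitI) (use that c seg in auto)
    then have V: "boundary_circles G {} = {{f, p, q, r}}"
      unfolding circles by auto
    have "card {{f, q}, {p, r}} = 2" using neq by (simp add: doubleton_eq_iff)
    \<comment> \<open>The diagonally opposite flags \<open>f\<close> and \<open>r\<close> form one
      colour class, which all three involutions exchange with \<open>{p, q}\<close>.\<close>
    moreover have "orientable G"
      unfolding orientable_def by (rule exI[of _ "{f, r}"]) (use c seg side neq F in auto)
    ultimately show thesis
      using isolated is_one_edge_graph_iff[OF e isolated] V B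
      by (intro that[of OL])
        (simp_all add: rho_def num_vertices_def vertices_def num_boundary_def split: edge_type.split)
  next
    case c: opp
    have "(steps {f, p, q, r} (corner G) (seg G))\<^sup>* `` {x} = {f, p, q, r}" if "x \<in> {f, p, q, r}" for x
      by (rule orbitI) (use that c seg in auto)
    then have V: "boundary_circles G {} = {{f, p, q, r}}"
      unfolding circles by auto
    have "(steps {f, p, q, r} (corner G) (side G))\<^sup>* `` {x} = {f, p, q, r}" if "x \<in> {f, p, q, r}" for x
      by (rule orbitI) (use that c side in auto)
    then have B: "boundary_circles G {e} = {{f, p, q, r}}"
      unfolding circles by auto
    \<comment> \<open>Here \<open>corner\<close> equals \<open>seg\<close> after
      \<open>side\<close>: one colour change against two.\<close>
    have "\<not> orientable G"
      unfolding orientable_def using c seg side F by (metis insertCI)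
    then show thesis
      using isolated is_one_edge_graph_iff[OF e isolated] V B
      by (intro that[of NL])
        (simp_all add: rho_def num_vertices_def vertices_def num_boundary_def split: edge_type.split)
  qed
qed

section \<open>Edge types and \<open>rho\<close>\<close>

lemma is_one_edge_graph_remove_isolated:
  assumes "ribbon_graph G" "edges G = {e}"
  shows "\<exists>i. is_one_edge_graph (remove_isolated G) i"
    and "is_one_edge_graph (remove_isolated G) i \<Longrightarrow> rho G {e} = type_rank i"
proof -
  have G: "ribbon_graph (remove_isolated G)" "edges (remove_isolated G) = {e}"
    "isolated (remove_isolated G) = 0"
    using assms by simp_all
  obtain j where j: "\<And>i. is_one_edge_graph (remove_isolated G) i \<longleftrightarrow> i = j"
    "rho (remove_isolated G) {e} = type_rank j"
    using one_edge_graph[OF G] by blast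
  then show "\<exists>i. is_one_edge_graph (remove_isolated G) i"
    and "is_one_edge_graph (remove_isolated G) i \<Longrightarrow> rho G {e} = type_rank i"
    by (simp_all add: rho_remove_isolated)
qed

text \<open>The number of vertices cancels. Contraction changes that number, while the boundary
  counts that remain can be transferred.\<close>

lemma rho_diff:
  assumes "card A = Suc (card B)"
  shows "rho G A - rho G B = (1 + of_nat (num_boundary G B) - of_nat (num_boundary G A)) / 2"
  using assms by (simp add: rho_def field_simps)

lemma rho_empty [simp]: "rho G {} = 0"
  by (simp add: rho_def num_vertices_eq)

lemma edge_has_type_exists:
  assumes G: "ribbon_graph G" and e: "e \<in> edges G"
  shows "\<exists>i j. edge_has_type G e i j"
proof -
  obtain es where es: "set es = edges G - {e}" "distinct es"
    using finite_distinct_list[of "edges G - {e}"] finite_edges[OF G] by auto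
  then have "edges G - set es = {e}" "set es \<subseteq> edges G" using e by auto
  then show ?thesis
    using es is_one_edge_graph_remove_isolated(1)[of "contract_list G es" e]
      is_one_edge_graph_remove_isolated(1)[of "delete_list G es" e]
      contract_list(1,2)[OF G es(2)] delete_list(1,2)[OF G es(2)]
    unfolding edge_has_type_def by metis
qed

text \<open>The boundary counts of the contracted minor for \<open>{}\<close> and \<open>{e}\<close>
  are those of \<open>G\<close> for \<open>edges G - {e}\<close> and \<open>edges G\<close>, so its
  \<open>rho\<close> of \<open>{e}\<close> is the last increment of \<open>rho G\<close>. The
  deleted minor keeps \<open>rho G {e}\<close>.\<close>

lemma edge_has_type_rho:
  assumes G: "ribbon_graph G" and e: "e \<in> edges G" and type: "edge_has_type G e i j"
  shows "rho G (edges G) - rho G (edges G - {e}) = type_rank i" "rho G {e} = type_rank j"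
proof -
  obtain es where es: "distinct es" "set es = edges G - {e}"
    and i: "is_one_edge_graph (remove_isolated (contract_list G es)) i"
    and j: "is_one_edge_graph (remove_isolated (delete_list G es)) j"
    using type unfolding edge_has_type_def by blast
  have sub: "set es \<subseteq> edges G" and diff: "edges G - set es = {e}" using es e by auto
  note C = contract_list[OF G es(1) sub, unfolded diff]
  note D = delete_list[OF G es(1) sub, unfolded diff]
  have "card (edges G) = Suc (card (edges G - {e}))"
    using card_Suc_Diff1[OF finite_edges[OF G] e] by simp
  moreover have "insert e (set es) = edges G" using es e by auto
  ultimately have "rho G (edges G) - rho G (edges G - {e}) = rho (contract_list G es) {e}"
    using C(3)[of "{}"] C(3)[of "{e}"] es(2) by (simp add: rho_diff, simp add: rho_def num_vertices_eq)
  then show "rho G (edges G) - rho G (edges G - {e}) = type_rank i"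
    using is_one_edge_graph_remove_isolated(2)[OF C(1,2) i] by simp
  have "rho G {e} = rho (delete_list G es) {e}"
    using D(3)[of "{}"] D(3)[of "{e}"] by (simp add: rho_def num_vertices_eq)
  then show "rho G {e} = type_rank j"
    using is_one_edge_graph_remove_isolated(2)[OF D(1,2) j] by simp
qed

lemma rho_delete:
  assumes "ribbon_graph G" "e \<in> edges G" "B \<subseteq> edges G - {e}"
  shows "rho (delete G e) B = rho G B"
  using num_boundary_delete[OF assms(1,2), of "{}"] num_boundary_delete[OF assms]
  by (simp add: rho_def num_vertices_eq)

text \<open>The contraction has \<open>num_boundary G {e}\<close> vertices; this replaces
  \<open>num_vertices G\<close> in \<open>rho\<close> and produces the shift by
  \<open>rho G {e}\<close>.\<close>

lemma rho_contract:
  assumes "ribbon_graph G" "e \<in> edges G" "B \<subseteq> edges G - {e}"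
  shows "rho (contract G e) B = rho G (insert e B) - rho G {e}"
proof -
  have "finite B" "e \<notin> B" using finite_edges[OF assms(1)] assms(3) finite_subset by auto
  then show ?thesis
    using num_boundary_contract[OF assms(1,2), of "{}"] num_boundary_contract[OF assms]
    by (simp add: rho_def num_vertices_eq field_simps)
qed

section \<open>The state sum\<close>

definition state_monom :: "rat \<Rightarrow> rat \<Rightarrow> rat \<Rightarrow> rat \<Rightarrow> rat \<Rightarrow> var gmonom" where
  "state_monom g ab aol bb bol = Poly_Mapping.single Gam g + Poly_Mapping.single A_b ab +
     Poly_Mapping.single A_ol aol + Poly_Mapping.single B_b bb + Poly_Mapping.single B_ol bol"

definition state_term :: "'a ribbon \<Rightarrow> 'a set set \<Rightarrow> var gpoly" where
  "state_term G A = Poly_Mapping.single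
     (state_monom (of_nat (num_boundary G A))
        (rho_total G - rho G A) (of_nat (card (edges G)) - of_nat (card A) - rho_total G + rho G A)
        (rho G A) (of_nat (card A) - rho G A)) 1"

definition state_sum :: "'a ribbon \<Rightarrow> var gpoly" where
  "state_sum G = (\<Sum>A\<in>Pow (edges G). state_term G A)"

lemma lookup_state_monom [simp]:
  "Poly_Mapping.lookup (state_monom g ab aol bb bol) v =
     (case v of Gam \<Rightarrow> g | A_b \<Rightarrow> ab | A_ol \<Rightarrow> aol | B_b \<Rightarrow> bb | B_ol \<Rightarrow> bol)"
  by (simp add: state_monom_def lookup_add lookup_single when_def split: var.split)

lemma state_monom_eqI:
  assumes "Poly_Mapping.lookup m Gam = g" "Poly_Mapping.lookup m A_b = ab"
    "Poly_Mapping.lookup m A_ol = aol" "Poly_Mapping.lookup m B_b = bb"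
    "Poly_Mapping.lookup m B_ol = bol"
  shows "m = state_monom g ab aol bb bol"
  by (rule poly_mapping_eqI) (use assms in \<open>auto split: var.split\<close>)

text \<open>Exponents \<open>r\<close> and \<open>1 - r\<close> with \<open>r = type_rank i\<close>
  treat the three types uniformly; the square roots in the coefficients for nl are what makes that
  case fit.\<close>

lemma a_coeff_eq: "a_coeff i = Poly_Mapping.single (state_monom 0 (type_rank i) (1 - type_rank i) 0 0) 1"
  and b_coeff_eq: "b_coeff i = Poly_Mapping.single (state_monom 0 0 0 (type_rank i) (1 - type_rank i)) 1"
  by (cases i; simp add: var_pow_def mult_single state_monom_def)+

lemma state_monom_add:
  "state_monom g ab aol bb bol + state_monom g' ab' aol' bb' bol' =
     state_monom (g + g') (ab + ab') (aol + aol') (bb + bb') (bol + bol')"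
  by (rule state_monom_eqI) (simp_all add: lookup_add)

lemma state_sum_recursion:
  assumes G: "ribbon_graph G" and e: "e \<in> edges G" and type: "edge_has_type G e i j"
  shows "state_sum G = a_coeff i * state_sum (delete G e) + b_coeff j * state_sum (contract G e)"
proof -
  let ?E = "edges G - {e}"
  note rank = edge_has_type_rho[OF G e type]
  have fin: "finite ?E" using finite_edges[OF G] by simp
  have E: "edges G = insert e ?E" using e by auto
  have card_E: "card (edges G) = Suc (card ?E)"
    using card_Suc_Diff1[OF finite_edges[OF G] e] by simp
  \<comment> \<open>Deletion lowers \<open>rho_total\<close> by \<open>type_rank i\<close> and the
    number of edges by 1. Only the exponents of \<open>A_b\<close> and \<open>A_ol\<close> change:
    they drop by \<open>type_rank i\<close> and \<open>1 - type_rank i\<close>.\<close>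
  have del: "state_term G A = a_coeff i * state_term (delete G e) A" if "A \<in> Pow ?E" for A
  proof -
    have A: "A \<subseteq> ?E" using that by simp
    have "rho (delete G e) ?E = rho_total G - type_rank i"
      using rho_delete[OF G e order.refl] rank by simp
    then show ?thesis
      by (simp add: state_term_def a_coeff_eq mult_single state_monom_add rho_delete[OF G e A]
          num_boundary_delete[OF G e A] edges_delete[OF G e] card_E)
        (simp add: algebra_simps)
  qed
  \<comment> \<open>Contraction lowers \<open>rho_total\<close> and the \<open>rho\<close> of the
    subset both by \<open>type_rank j\<close>. The changes cancel for \<open>A_b\<close> and
    \<open>A_ol\<close>, while \<open>B_b\<close> and \<open>B_ol\<close> supply the factor
    \<open>b_coeff j\<close>.\<close>
  have con: "state_term G (insert e A) = b_coeff j * state_term (contract G e) A" if "A \<in> Pow ?E" for A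
  proof -
    have A: "A \<subseteq> ?E" using that by simp
    have "card (insert e A) = Suc (card A)"
      using finite_subset[OF A fin] A by (intro card_insert_disjoint) auto
    moreover have "rho (contract G e) ?E = rho_total G - type_rank j"
      using rho_contract[OF G e order.refl] rank E by simp
    ultimately show ?thesis
      by (simp add: state_term_def b_coeff_eq mult_single state_monom_add rho_contract[OF G e A]
          num_boundary_contract[OF G e A] edges_contract[OF G e] card_E rank)
        (simp add: algebra_simps)
  qed
  have "state_sum G = (\<Sum>A\<in>Pow ?E \<union> insert e ` Pow ?E. state_term G A)"
    using Pow_insert[of e ?E] E[symmetric] by (simp only: state_sum_def)
  also have "\<dots> = (\<Sum>A\<in>Pow ?E. state_term G A) + (\<Sum>A\<in>insert e ` Pow ?E. state_term G A)"
    using fin by (intro sum.union_disjoint) auto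
  also have "(\<Sum>A\<in>insert e ` Pow ?E. state_term G A) = (\<Sum>A\<in>Pow ?E. state_term G (insert e A))"
    by (subst sum.reindex) (auto simp: inj_on_def dest: insert_ident[THEN iffD1, rotated 2])
  finally show ?thesis
    using del con unfolding state_sum_def edges_delete[OF G e] edges_contract[OF G e]
    by (simp add: sum_distrib_left)
qed

lemma var_pow_power: "var_pow v r ^ n = var_pow v (of_nat n * r)"
  by (induction n) (simp_all add: var_pow_def mult_single single_add[symmetric] distrib_right)

lemma state_sum_edgeless: "edges G = {} \<Longrightarrow> state_sum G = var_pow Gam 1 ^ num_vertices G"
  by (simp add: state_sum_def state_term_def state_monom_def var_pow_power num_vertices_eq)
    (simp add: var_pow_def)

section \<open>Admissible exponents\<close>

lemma coeff_ring_add: "p \<in> coeff_ring \<Longrightarrow> q \<in> coeff_ring \<Longrightarrow> p + q \<in> coeff_ring"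
  using keys_add[of p q] unfolding coeff_ring_def by blast

lemma coeff_ring_mult:
  assumes "p \<in> coeff_ring" "q \<in> coeff_ring"
  shows "p * q \<in> coeff_ring"
  unfolding coeff_ring_def
proof (intro CollectI ballI)
  fix m assume "m \<in> Poly_Mapping.keys (p * q)"
  then obtain k l where "m = k + l" "k \<in> Poly_Mapping.keys p" "l \<in> Poly_Mapping.keys q"
    using keys_mult[of p q] by blast
  then show "Poly_Mapping.lookup m Gam \<in> \<nat> \<and> (\<forall>v. 2 * Poly_Mapping.lookup m v \<in> \<nat>)"
    using assms by (simp add: coeff_ring_def lookup_add distrib_left)
qed

lemma single_state_monom_in_coeff_ring:
  assumes "g \<in> \<nat>" "2 * ab \<in> \<nat>" "2 * aol \<in> \<nat>" "2 * bb \<in> \<nat>" "2 * bol \<in> \<nat>"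
  shows "Poly_Mapping.single (state_monom g ab aol bb bol) 1 \<in> coeff_ring"
  using assms by (auto simp: coeff_ring_def split: var.split)

text \<open>No bound on the exponents of a single \<open>state_term\<close> is established directly:
  each recursion step multiplies by monomials with exponents 0, 1/2 or 1, starting from a power of
  the variable \<open>Gam\<close>.\<close>

lemma state_sum_in_coeff_ring: "ribbon_graph G \<Longrightarrow> state_sum G \<in> coeff_ring"
proof (induction "card (edges G)" arbitrary: G)
  case 0
  then have E: "edges G = {}" using finite_edges by fastforce
  show ?case
    by (simp add: state_sum_def state_term_def E single_state_monom_in_coeff_ring)
next
  case (Suc n)
  then obtain e where e: "e \<in> edges G" by fastforce
  obtain i j where ij: "edge_has_type G e i j"
    using edge_has_type_exists[OF Suc.prems e] by blast
  have "n = card (edges G - {e})" using Suc e by simp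
  then have "state_sum (delete G e) \<in> coeff_ring" "state_sum (contract G e) \<in> coeff_ring"
    using Suc e by (simp_all add: ribbon_graph_delete edges_delete ribbon_graph_contract edges_contract)
  moreover have "2 * type_rank k \<in> \<nat>" "2 * (1 - type_rank k) \<in> \<nat>" for k
    by (cases k; simp)+
  ultimately show ?case
    unfolding state_sum_recursion[OF Suc.prems e ij] a_coeff_eq b_coeff_eq
    by (intro coeff_ring_add coeff_ring_mult single_state_monom_in_coeff_ring) auto
qed

section \<open>The Tutte polynomial\<close>

abbreviation subst_exponents :: "('u \<Rightarrow> 'v gmonom) \<Rightarrow> 'u gmonom \<Rightarrow> 'v gmonom" where
  "subst_exponents \<sigma> m \<equiv>
     (\<Sum>u\<in>Poly_Mapping.keys m. Poly_Mapping.map ((*) (Poly_Mapping.lookup m u)) (\<sigma> u))"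

lemma lookup_map_times [simp]:
  "Poly_Mapping.lookup (Poly_Mapping.map ((*) r) m) v = r * Poly_Mapping.lookup m v"
  for r :: rat
  by (simp add: Poly_Mapping.map.rep_eq when_def)

text \<open>Keys may cancel in a sum, so additivity is proved over one common finite index set,
  where the extra terms vanish.\<close>

lemma subst_monom_superset:
  assumes "finite S" "Poly_Mapping.keys p \<subseteq> S"
  shows "subst_monom \<sigma> p =
    (\<Sum>m\<in>S. Poly_Mapping.single (subst_exponents \<sigma> m) (Poly_Mapping.lookup p m))"
  unfolding subst_monom_def
  by (rule sum.mono_neutral_left) (use assms in \<open>auto simp: in_keys_iff\<close>)

lemma subst_monom_add: "subst_monom \<sigma> (p + q) = subst_monom \<sigma> p + subst_monom \<sigma> q"
proof -
  let ?S = "Poly_Mapping.keys p \<union> Poly_Mapping.keys q"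
  have "subst_monom \<sigma> r = (\<Sum>m\<in>?S. Poly_Mapping.single (subst_exponents \<sigma> m) (Poly_Mapping.lookup r m))"
    if "Poly_Mapping.keys r \<subseteq> ?S" for r
    using that by (intro subst_monom_superset) auto
  then show ?thesis
    using keys_add[of p q] by (simp add: lookup_add single_add sum.distrib)
qed

lemma subst_monom_sum: "subst_monom \<sigma> (\<Sum>x\<in>A. p x) = (\<Sum>x\<in>A. subst_monom \<sigma> (p x))"
proof (induction A rule: infinite_finite_induct)
  case (insert x A)
  then show ?case by (simp add: subst_monom_add)
qed (simp_all add: subst_monom_def)

lemma subst_monom_single:
  "subst_monom \<sigma> (Poly_Mapping.single m 1) = Poly_Mapping.single (subst_exponents \<sigma> m) 1"
  by (simp add: subst_monom_def)

lemma lookup_subst_exponents: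
  assumes "finite S" "Poly_Mapping.keys m \<subseteq> S"
  shows "Poly_Mapping.lookup (subst_exponents \<sigma> m) v =
    (\<Sum>u\<in>S. Poly_Mapping.lookup m u * Poly_Mapping.lookup (\<sigma> u) v)"
proof -
  have "Poly_Mapping.lookup (subst_exponents \<sigma> m) v =
      (\<Sum>u\<in>Poly_Mapping.keys m. Poly_Mapping.lookup m u * Poly_Mapping.lookup (\<sigma> u) v)"
    by (simp add: lookup_sum)
  also have "\<dots> = (\<Sum>u\<in>S. Poly_Mapping.lookup m u * Poly_Mapping.lookup (\<sigma> u) v)"
    by (rule sum.mono_neutral_left) (use assms in \<open>auto simp: in_keys_iff\<close>)
  finally show ?thesis .
qed

lemma subst_monom_tutte_args:
  "subst_monom tutte_args (var_pow X r * var_pow Y s) =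
     Poly_Mapping.single (state_monom (r + s) r (- s) (- r) s) 1"
proof -
  let ?m = "Poly_Mapping.single X r + Poly_Mapping.single Y s"
  \<comment> \<open>The keys of \<open>?m\<close> shrink when \<open>r\<close> or \<open>s\<close>
    is 0, hence the fixed index set \<open>{X, Y}\<close>.\<close>
  have "UNIV = {X, Y}" using xy.exhaust by blast
  then have "Poly_Mapping.keys ?m \<subseteq> {X, Y}" by auto
  then have "Poly_Mapping.lookup (subst_exponents tutte_args ?m) v =
      r * Poly_Mapping.lookup (tutte_args X) v + s * Poly_Mapping.lookup (tutte_args Y) v" for v
    by (subst lookup_subst_exponents[of "{X, Y}"]) (simp_all add: lookup_add lookup_single)
  then have "subst_exponents tutte_args ?m = state_monom (r + s) r (- s) (- r) s"
    by (intro state_monom_eqI) (simp_all add: lookup_add lookup_minus lookup_single)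
  then show ?thesis
    by (simp add: var_pow_def mult_single subst_monom_single)
qed

lemma state_sum_eq_tutte:
  "state_sum G =
     var_pow Gam (of_nat (num_vertices G) - rho_total G) * var_pow B_b (rho_total G) *
     var_pow A_ol (of_nat (card (edges G)) - rho_total G) *
     subst_monom tutte_args (tutte_cs G)"
proof -
  let ?m = "state_monom (of_nat (num_vertices G) - rho_total G) 0
    (of_nat (card (edges G)) - rho_total G) (rho_total G) 0"
  have "var_pow Gam (of_nat (num_vertices G) - rho_total G) * var_pow B_b (rho_total G) *
      var_pow A_ol (of_nat (card (edges G)) - rho_total G) = Poly_Mapping.single ?m 1"
    by (simp add: var_pow_def mult_single state_monom_def algebra_simps)
  moreover have "state_term G A = Poly_Mapping.single ?m 1 *
      subst_monom tutte_args (var_pow X (rho_total G - rho G A) * var_pow Y (of_nat (card A) - rho G A))"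
    for A
  proof -
    \<comment> \<open>This is the \<open>Gam\<close> exponent on the Tutte side:
      \<open>num_vertices G - rho_total G\<close> from the prefactor plus the exponents of both
      Tutte variables.\<close>
    have nb: "of_nat (num_boundary G A) = of_nat (num_vertices G) + of_nat (card A) - 2 * rho G A"
      by (simp add: rho_def field_simps)
    show ?thesis
      unfolding state_term_def nb subst_monom_tutte_args mult_single state_monom_add
      by (simp add: algebra_simps)
  qed
  ultimately show ?thesis
    by (simp add: state_sum_def tutte_cs_def subst_monom_sum sum_distrib_left)
qed

section \<open>Invariance under homeomorphism\<close>

text \<open>A state term depends only on cardinalities and boundary counts. These are preserved by
  the action of \<phi> on edges, edge sets and boundary circles, so the terms match one by
  one.\<close>

lemma state_sum_homeomorphic:
  assumes G: "ribbon_graph G" and H: "ribbon_graph H" and hom: "homeomorphic_rg G H"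
  shows "state_sum G = state_sum H"
proof -
  obtain \<phi> where \<phi>: "bij_betw \<phi> (flags G) (flags H)" and isolated: "isolated G = isolated H"
    and comm: "\<And>f. f \<in> flags G \<Longrightarrow> seg H (\<phi> f) = \<phi> (seg G f)"
      "\<And>f. f \<in> flags G \<Longrightarrow> side H (\<phi> f) = \<phi> (side G f)"
      "\<And>f. f \<in> flags G \<Longrightarrow> corner H (\<phi> f) = \<phi> (corner G f)"
    using hom unfolding homeomorphic_rg_def by auto
  have inj: "inj_on \<phi> (flags G)" and flags: "flags H = \<phi> ` flags G"
    using \<phi> by (auto simp: bij_betw_def)
  have edges_Pow: "edges G \<subseteq> Pow (flags G)" using edgeD(1)[OF G] by blast
  have inj_Pow: "inj_on ((`) \<phi>) (Pow (flags G))" using inj by (rule inj_on_image_Pow)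
  then have inj_edges: "inj_on ((`) \<phi>) (edges G)" using edges_Pow inj_on_subset by blast
  have "edge_of H (\<phi> f) = \<phi> ` edge_of G f" if "f \<in> flags G" for f
    using comm ribbon_graphD(2)[OF G that] that by (simp add: edge_of_def)
  then have edges: "edges H = (`) \<phi> ` edges G"
    by (auto simp: edges_eq_edge_of flags)
  have num_boundary: "num_boundary H ((`) \<phi> ` A) = num_boundary G A" if A: "A \<subseteq> edges G" for A
  proof -
    have cross: "cross H ((`) \<phi> ` A) (\<phi> f) = \<phi> (cross G A f)" if f: "f \<in> flags G" for f
    proof -
      have "\<Union>A \<subseteq> flags G" using A edges_Pow by blast
      then have "\<phi> f \<in> \<phi> ` \<Union>A \<longleftrightarrow> f \<in> \<Union>A" using inj f by (simp add: inj_on_image_mem_iff)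
      moreover have "\<Union>((`) \<phi> ` A) = \<phi> ` \<Union>A" by blast
      ultimately show ?thesis using comm f by (simp add: cross_def)
    qed
    have closed: "corner G ` flags G \<subseteq> flags G" "cross G A ` flags G \<subseteq> flags G"
      using ribbon_graphD(3)[OF G] free_involution_cross[OF G A] by (auto simp: free_involution_on_def)
    have "boundary_circles H ((`) \<phi> ` A) = (`) \<phi> ` boundary_circles G A"
      unfolding boundary_circles_eq_orbits flags
      by (rule orbits_image[OF closed]) (simp_all add: comm cross)
    moreover have "inj_on ((`) \<phi>) (boundary_circles G A)"
      using inj_Pow orbits_subset_Pow[OF closed] unfolding boundary_circles_eq_orbits
      by (rule inj_on_subset)
    ultimately show ?thesis
      by (simp add: num_boundary_def isolated card_image)
  qed
  have card: "card ((`) \<phi> ` A) = card A" if "A \<subseteq> edges G" for A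
    using inj_edges that by (meson card_image inj_on_subset)
  have rho: "rho H ((`) \<phi> ` A) = rho G A" if "A \<subseteq> edges G" for A
    using num_boundary[of "{}"] num_boundary[OF that] card[OF that]
    by (simp add: rho_def num_vertices_eq)
  have "state_term H ((`) \<phi> ` A) = state_term G A" if "A \<subseteq> edges G" for A
    using num_boundary[OF that] card[OF that] rho[OF that] card[OF order.refl] rho[OF order.refl]
    by (simp add: state_term_def edges)
  \<comment> \<open>The sum is reindexed two levels above the flags, over sets of edges that are
    themselves sets of flags.\<close>
  moreover have "Pow (edges H) = (`) ((`) \<phi>) ` Pow (edges G)"
    unfolding edges by (rule image_Pow_surj[OF refl, symmetric])
  moreover have "inj_on ((`) ((`) \<phi>)) (Pow (edges G))"
    using inj_edges by (rule inj_on_image_Pow)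
  ultimately show ?thesis
    by (simp add: state_sum_def sum.reindex)
qed

section \<open>Existence and uniqueness\<close>

lemma minor_closedD:
  assumes "minor_closed \<G>" "G \<in> \<G>"
  shows "ribbon_graph G" "e \<in> edges G \<Longrightarrow> delete G e \<in> \<G>" "e \<in> edges G \<Longrightarrow> contract G e \<in> \<G>"
  using assms by (auto simp: minor_closed_def)

text \<open>Minor closure keeps both minors inside \<open>\<G>\<close>, where the restriction does
  not alter \<open>state_sum\<close>.\<close>

lemma deletion_contraction_map_state_sum:
  assumes "minor_closed \<G>"
  shows "deletion_contraction_map \<G> (restrict state_sum \<G>)"
  unfolding deletion_contraction_map_def
proof (intro conjI ballI allI impI)
  show "restrict state_sum \<G> \<in> \<G> \<rightarrow>\<^sub>E coeff_ring"
    using minor_closedD(1)[OF assms] state_sum_in_coeff_ring by auto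
next
  fix G e i j assume "G \<in> \<G>" "e \<in> edges G" "edge_has_type G e i j"
  then show "restrict state_sum \<G> G =
      a_coeff i * restrict state_sum \<G> (delete G e) + b_coeff j * restrict state_sum \<G> (contract G e)"
    using minor_closedD[OF assms, of G] state_sum_recursion[of G e i j] by simp
next
  fix G assume "G \<in> \<G>" "edges G = {}"
  then show "restrict state_sum \<G> G = var_pow Gam 1 ^ num_vertices G"
    by (simp add: state_sum_edgeless)
qed

text \<open>Comparison with \<open>state_sum\<close> gives uniqueness and also carries the closed
  formula and homeomorphism invariance over to \<open>U\<close>.\<close>

lemma deletion_contraction_map_unique:
  assumes closed: "minor_closed \<G>" and U: "deletion_contraction_map \<G> U" and "G \<in> \<G>"
  shows "U G = state_sum G"
  using assms(3)
proof (induction "card (edges G)" arbitrary: G)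
  case 0
  then have "edges G = {}" using finite_edges minor_closedD[OF closed] by fastforce
  then show ?case
    using U 0 by (simp add: deletion_contraction_map_def state_sum_edgeless)
next
  case (Suc n)
  note G = minor_closedD[OF closed Suc.prems]
  obtain e where e: "e \<in> edges G" using Suc by fastforce
  obtain i j where ij: "edge_has_type G e i j"
    using edge_has_type_exists[OF G(1) e] by blast
  have "n = card (edges G - {e})" using Suc e by simp
  then have "U (delete G e) = state_sum (delete G e)" "U (contract G e) = state_sum (contract G e)"
    using Suc G e by (simp_all add: edges_delete edges_contract)
  moreover have "U G = a_coeff i * U (delete G e) + b_coeff j * U (contract G e)"
    using U Suc.prems e ij by (simp add: deletion_contraction_map_def)
  ultimately show ?case by (simp add: state_sum_recursion[OF G(1) e ij])
qed

theorem theorem4p2: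
  fixes \<G> :: "'a ribbon set"
  assumes "minor_closed \<G>"
  shows "(\<exists>!U. deletion_contraction_map \<G> U) \<and>
    (\<forall>U. deletion_contraction_map \<G> U \<longrightarrow>
       homeo_invariant_on \<G> U \<and>
       (\<forall>G\<in>\<G>. U G =
          var_pow Gam (of_nat (num_vertices G) - rho_total G) * var_pow B_b (rho_total G) *
          var_pow A_ol (of_nat (card (edges G)) - rho_total G) *
          subst_monom tutte_args (tutte_cs G)))"
proof (intro conjI allI impI)
  note unique = deletion_contraction_map_unique[OF assms]
  show "\<exists>!U. deletion_contraction_map \<G> U"
  proof (rule ex1I)
    show "deletion_contraction_map \<G> (restrict state_sum \<G>)"
      using deletion_contraction_map_state_sum[OF assms] .
  next
    fix U assume U: "deletion_contraction_map \<G> U"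
    \<comment> \<open>Outside \<open>\<G>\<close> extensionality fixes the values.\<close>
    then have "U \<in> extensional \<G>" by (auto simp: deletion_contraction_map_def PiE_def)
    then show "U = restrict state_sum \<G>"
      by (rule extensionalityI) (use unique[OF U] in auto)
  qed
  fix U assume U: "deletion_contraction_map \<G> U"
  show "homeo_invariant_on \<G> U"
    unfolding homeo_invariant_on_def
    using unique[OF U] state_sum_homeomorphic minor_closedD(1)[OF assms] by metis
  show "\<forall>G\<in>\<G>. U G =
      var_pow Gam (of_nat (num_vertices G) - rho_total G) * var_pow B_b (rho_total G) *
      var_pow A_ol (of_nat (card (edges G)) - rho_total G) *
      subst_monom tutte_args (tutte_cs G)"
    using unique[OF U] state_sum_eq_tutte by metis
qed

end
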